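(* Let $n\ge 2$ and suppose $(X_1,Y_1),\ldots,(X_n,Y_n)\in\mathcal{X}\times\mathcal{Y}$ are independent and identically distributed observations from a probability measure $P$ on $\mathcal{X}\times\mathcal{Y}$, with marginals $P_X$ and $P_Y$. Suppose $\widehat{f}_X:\mathcal{X}\to\mathbb{R}$ and $\widehat{f}_Y:\mathcal{Y}\to\mathbb{R}$ are (measurable) data-dependent transformations depending permutation invariantly only on $(X_1,\ldots,X_n)$ and only on $(Y_1,\ldots,Y_n)$, respectively. Then, under $H_0: P=P_X\otimes P_Y$, the statistic $$\rho_n(\widehat{f}_X,\widehat{f}_Y) := 1-\frac{6}{n}\sum_{i=1}^n\frac{(R_i^X-R_i^Y)^2}{n^2-1},$$ where $$R_i^X:=\mathrm{rank}(\widehat{f}_X(X_i);\{\widehat{f}_X(X_1),\ldots,\widehat{f}_X(X_n)\}),\qquad R_i^Y:=\mathrm{rank}(\widehat{f}_Y(Y_i);\{\widehat{f}_Y(Y_1),\ldots,\widehat{f}_Y(Y_n)\}),$$ has the same distribution as Spearman's rank correlation (for sample size $n$) under $H_0$.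
   Context: $\mathcal{X},\mathcal{Y}$ are arbitrary measurable spaces. $P_X\otimes P_Y$ is the product measure. Permutation invariance: $\widehat{f}_X(x)=\widehat{f}_X(x;X_1,\ldots,X_n)$ is a fixed measurable function of $x$ and the data $X_1,\ldots,X_n$, with $\widehat{f}_X(x;X_1,\ldots,X_n)=\widehat{f}_X(x;X_{\pi(1)},\ldots,X_{\pi(n)})$ for every $x$, all data values, and every permutation $\pi$ of $\{1,\ldots,n\}$; similarly for $\widehat{f}_Y$ with the data $Y_1,\ldots,Y_n$. Rank (with random tie-breaking): for a finite sequence of real numbers $x_1,\ldots,x_n$ (ties allowed, the collection being understood as indexed), fix an arbitrary $\xi>0$ and let $U_1,\ldots,U_n$ be i.i.d. $\mathrm{Unif}[-1,1]$, independent of the data; the same $U_1,\ldots,U_n$ are used for all ranks in one collection. Then $$\mathrm{rank}(x_i;\{x_1,\ldots,x_n\}) := |\{j\in\{1,\ldots,n\}: x_j+\xi U_j\le x_i+\xi U_i\}|.$$ The jitter variables used for the $X$-ranks and those used for the $Y$-ranks are independent of each other. Distributions of ranks include the randomness of the jitter variables. Spearman's rank correlation: for real-valued i.i.d. pairs $(X_1,Y_1),\ldots,(X_n,Y_n)\in\mathbb{R}^2$, it is $\rho_n:=1-\frac{6}{n}\sum_{i=1}^n\frac{(R_i^X-R_i^Y)^2}{n^2-1}$, where $R_i^X=\mathrm{rank}(X_i;\{X_1,\ldots,X_n\})$ and $R_i^Y=\mathrm{rank}(Y_i;\{Y_1,\ldots,Y_n\})$. Its distribution under $H_0$ (the two coordinates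 independent) does not depend on the marginals. *)

theory Defs
  imports "HOL-Probability.Probability"
begin

text \<open>
  Samples and jitters are indexed by \<open>{1..n}\<close>. Below, \<open>u\<close> is a realisation of the jitter
  variables and \<open>x\<close> the indexed collection being ranked; ties among the \<open>x j\<close> are allowed.
\<close>

definition jitter_rank :: "real \<Rightarrow> nat \<Rightarrow> (nat \<Rightarrow> real) \<Rightarrow> (nat \<Rightarrow> real) \<Rightarrow> nat \<Rightarrow> nat" where
  "jitter_rank \<xi> n u x i = card {j \<in> {1..n}. x j + \<xi> * u j \<le> x i + \<xi> * u i}"

definition spearman_rho ::
  "real \<Rightarrow> nat \<Rightarrow> (nat \<Rightarrow> real) \<Rightarrow> (nat \<Rightarrow> real) \<Rightarrow> (nat \<Rightarrow> real) \<Rightarrow> (nat \<Rightarrow> real) \<Rightarrow> real" where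
  "spearman_rho \<xi> n u v x y =
     1 - 6 / real n *
       (\<Sum>i=1..n. (real (jitter_rank \<xi> n u x i) - real (jitter_rank \<xi> n v y i))\<^sup>2
                    / ((real n)\<^sup>2 - 1))"

text \<open>
  A data-dependent transformation is a function of an evaluation point and of the data
  \<open>d\<close>, the latter being a point of the product space over \<open>{1..n}\<close>.
\<close>

definition perm_invariant_transform ::
  "nat \<Rightarrow> 'a measure \<Rightarrow> ('a \<Rightarrow> (nat \<Rightarrow> 'a) \<Rightarrow> real) \<Rightarrow> bool" where
  "perm_invariant_transform n S f \<longleftrightarrow>
     (\<lambda>(x, d). f x d) \<in> borel_measurable (S \<Otimes>\<^sub>M PiM {1..n} (\<lambda>_. S)) \<and>
     (\<forall>x\<in>space S. \<forall>d\<in>space (PiM {1..n} (\<lambda>_. S)). \<forall>\<pi>. \<pi> permutes {1..n} \<longrightarrow>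
        f x (\<lambda>i\<in>{1..n}. d (\<pi> i)) = f x d)"

text \<open>
  I.i.d. pairs with common law \<open>P\<close> on the product of \<open>S\<close> and \<open>T\<close>, together with the jitter
  variables \<open>U\<close> and \<open>V\<close> for the ranks of the first and second coordinates. The \<open>2 n\<close> jitter
  variables are indexed by a disjoint sum, so that \<open>jitter_indep\<close> also makes the two
  jitter families independent of each other. \<open>data_jitter_indep\<close> is stated with the generated
  sigma-algebras because \<open>indep_var\<close> requires both variables to have the same type.
\<close>

locale jittered_iid_sample = prob_space M
  for M :: "'w measure" and n :: nat
  and S :: "'a measure" and T :: "'b measure" and P :: "('a \<times> 'b) measure"
  and X :: "nat \<Rightarrow> 'w \<Rightarrow> 'a" and Y :: "nat \<Rightarrow> 'w \<Rightarrow> 'b"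
  and U V :: "nat \<Rightarrow> 'w \<Rightarrow> real" +
  assumes prob_P: "prob_space P"
    and sets_P: "sets P = sets (S \<Otimes>\<^sub>M T)"
    and pairs_indep: "indep_vars (\<lambda>_. P) (\<lambda>i \<omega>. (X i \<omega>, Y i \<omega>)) {1..n}"
    and pairs_distr: "\<And>i. i \<in> {1..n} \<Longrightarrow> distr M P (\<lambda>\<omega>. (X i \<omega>, Y i \<omega>)) = P"
    and jitter_indep: "indep_vars (\<lambda>_. borel) (case_sum U V) ({1..n} <+> {1..n})"
    and U_distr: "\<And>i. i \<in> {1..n} \<Longrightarrow> distr M borel (U i) = uniform_measure lborel {-1..1}"
    and V_distr: "\<And>i. i \<in> {1..n} \<Longrightarrow> distr M borel (V i) = uniform_measure lborel {-1..1}"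
    and data_jitter_indep:
      "indep_set
        {(\<lambda>\<omega>. \<lambda>i\<in>{1..n}. (X i \<omega>, Y i \<omega>)) -` A \<inter> space M | A.
           A \<in> sets (PiM {1..n} (\<lambda>_. P))}
        {(\<lambda>\<omega>. \<lambda>k\<in>{1..n} <+> {1..n}. case_sum U V k \<omega>) -` B \<inter> space M | B.
           B \<in> sets (PiM ({1..n} <+> {1..n}) (\<lambda>_. borel :: real measure))}"

end

theory Submission
  imports Defs
begin

text \<open>
  Under the null hypothesis, the law of the two samples and the jitters is a product measure, hence
  invariant under permuting the indices of the first sample and its jitters by \<open>\<pi>\<close>, and those of
  the second by an unrelated \<open>\<rho>\<close>. By permutation invariance of the transformations this turns the
  rank vectors \<open>(r, s)\<close> into \<open>(r \<circ> \<pi>, s \<circ> \<rho>)\<close>. The jitters exclude ties almost surely, so \<open>r\<close> and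
  \<open>s\<close> are permutations, and since all pairs of permutations are equally likely, \<open>(r, s)\<close> is
  uniform on pairs of permutations, whatever the marginals, the transformations and \<open>\<xi>\<close>. Spearman's
  correlation is the special case of the transformations that evaluate to the data point itself.
\<close>

section \<open>Laws on product spaces, and uniform laws on finite sets\<close>

text \<open>Fubini, integrating coordinate \<open>a\<close> first: with the other coordinates fixed,
  the event is a single point of an atomless law. The shift \<open>c\<close> will absorb the
  difference of two data values.\<close>

lemma AE_PiM_component_neq:
  fixes K :: "real measure"
  assumes K: "prob_space K" "sets K = sets borel" "\<And>c. emeasure K {c} = 0"
    and L: "finite L" "a \<in> L" "b \<in> L" "a \<noteq> b"
  shows "AE u in PiM L (\<lambda>_. K). u a \<noteq> u b + c"
proof -
  interpret product_sigma_finite "\<lambda>_. K"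
    by (simp add: product_sigma_finite_def K prob_space_imp_sigma_finite)
  note [measurable_cong] = K(2)
  have L_eq: "L = insert a (L - {a})" using L by blast
  have *[measurable]: "{u \<in> space (PiM L (\<lambda>_. K)). u a = u b + c} \<in> sets (PiM L (\<lambda>_. K))"
    using L by measurable
  have "emeasure (PiM L (\<lambda>_. K)) {u \<in> space (PiM L (\<lambda>_. K)). u a = u b + c} =
    (\<integral>\<^sup>+ u. indicator {u \<in> space (PiM L (\<lambda>_. K)). u a = u b + c} u
       \<partial>PiM (insert a (L - {a})) (\<lambda>_. K))"
    using * L_eq by (simp add: insert_absorb)
  also have "\<dots> = (\<integral>\<^sup>+ u. (\<integral>\<^sup>+ y. indicator {u \<in> space (PiM L (\<lambda>_. K)). u a = u b + c} (u(a := y))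
       \<partial>K) \<partial>PiM (L - {a}) (\<lambda>_. K))"
    using L L_eq * by (intro product_nn_integral_insert) (auto simp: insert_absorb)
  \<comment> \<open>Because \<open>a \<noteq> b\<close>, updating coordinate \<open>a\<close> leaves
    \<open>u b\<close> alone, so \<open>y\<close> is confined to the singleton
    \<open>{u b + c}\<close>.\<close>
  also have "\<dots> \<le> (\<integral>\<^sup>+ u. (\<integral>\<^sup>+ y. indicator {u b + c} y \<partial>K) \<partial>PiM (L - {a}) (\<lambda>_. K))"
    using L by (intro nn_integral_mono) (auto split: split_indicator)
  also have "\<dots> = 0"
    by (simp add: K)
  finally show ?thesis
    by (intro AE_I[OF _ _ *]) auto
qed

text \<open>It suffices to compare the measures on boxes, but the sides \<open>E i\<close> are
  arbitrary sets in \<open>A \<Otimes>\<^sub>M B\<close> and not rectangles. Hence Fubini: slice at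
  a fixed second sample, then integrate the product of the slice measures.\<close>

lemma distr_PiM_zip:
  assumes "prob_space A" "prob_space B" "finite I"
  shows "distr (PiM I (\<lambda>_. A) \<Otimes>\<^sub>M PiM I (\<lambda>_. B)) (PiM I (\<lambda>_. A \<Otimes>\<^sub>M B))
           (\<lambda>(x, y). \<lambda>i\<in>I. (x i, y i)) = PiM I (\<lambda>_. A \<Otimes>\<^sub>M B)" (is "distr ?Q ?R ?zip = _")
proof -
  interpret A: prob_space A by fact
  interpret B: prob_space B by fact
  interpret AB: pair_prob_space A B ..
  interpret PA: product_prob_space "\<lambda>_. A" I ..
  interpret PB: product_prob_space "\<lambda>_. B" I ..
  interpret PAB: product_prob_space "\<lambda>_. A \<Otimes>\<^sub>M B" I ..
  interpret Q: pair_prob_space "PiM I (\<lambda>_. A)" "PiM I (\<lambda>_. B)" ..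
  have zip[measurable]: "?zip \<in> measurable ?Q ?R"
    by measurable
  show ?thesis
  proof (rule PAB.PiM_eqI)
    fix E assume E: "\<And>i. i \<in> I \<Longrightarrow> E i \<in> sets (A \<Otimes>\<^sub>M B)"
    have box: "Pi\<^sub>E I E \<in> sets ?R"
      using E \<open>finite I\<close> by (intro sets_PiM_I_finite) auto
    have "emeasure (distr ?Q ?R ?zip) (Pi\<^sub>E I E) = emeasure ?Q (?zip -` Pi\<^sub>E I E \<inter> space ?Q)"
      using box by (simp add: emeasure_distr)
    also have "\<dots> = (\<integral>\<^sup>+ y. emeasure (PiM I (\<lambda>_. A))
        ((\<lambda>x. (x, y)) -` (?zip -` Pi\<^sub>E I E \<inter> space ?Q)) \<partial>PiM I (\<lambda>_. B))"
      by (rule Q.emeasure_pair_measure_alt2) (use box in measurable)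
    also have "\<dots> = (\<integral>\<^sup>+ y. (\<Prod>i\<in>I. emeasure A ((\<lambda>x. (x, y i)) -` E i)) \<partial>PiM I (\<lambda>_. B))"
    proof (rule nn_integral_cong)
      fix y assume y: "y \<in> space (PiM I (\<lambda>_. B))"
      \<comment> \<open>The slice of a zipped box at \<open>y\<close> is again a box, with sides the
        sections of \<open>E i\<close> at \<open>y i\<close>.\<close>
      have "(\<lambda>x. (x, y)) -` (?zip -` Pi\<^sub>E I E \<inter> space ?Q) = (\<Pi>\<^sub>E i\<in>I. (\<lambda>x. (x, y i)) -` E i)"
        using y sets.sets_into_space[OF E]
        by (force simp: space_pair_measure space_PiM PiE_iff restrict_def extensional_def)
      then show "emeasure (PiM I (\<lambda>_. A)) ((\<lambda>x. (x, y)) -` (?zip -` Pi\<^sub>E I E \<inter> space ?Q)) =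
          (\<Prod>i\<in>I. emeasure A ((\<lambda>x. (x, y i)) -` E i))"
        using PA.emeasure_PiM[OF \<open>finite I\<close>, of "\<lambda>i. (\<lambda>x. (x, y i)) -` E i"]
          sets_Pair2[OF E] by simp
    qed
    \<comment> \<open>The factor for \<open>i\<close> depends on \<open>y i\<close> alone, so the
      integral over the product measure factorises.\<close>
    also have "\<dots> = (\<Prod>i\<in>I. \<integral>\<^sup>+ y. emeasure A ((\<lambda>x. (x, y)) -` E i) \<partial>B)"
      using E \<open>finite I\<close>
      by (intro PB.product_nn_integral_prod AB.measurable_emeasure_Pair2) auto
    also have "\<dots> = (\<Prod>i\<in>I. emeasure (A \<Otimes>\<^sub>M B) (E i))"
      using E by (intro prod.cong refl AB.emeasure_pair_measure_alt2[symmetric])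
    finally show "emeasure (distr ?Q ?R ?zip) (Pi\<^sub>E I E) = (\<Prod>i\<in>I. emeasure (A \<Otimes>\<^sub>M B) (E i))" .
  qed (use \<open>finite I\<close> in auto)
qed

text \<open>The source measure is itself an image under zipping, and unzipping undoes zipping on the
  space of the product.\<close>

lemma distr_PiM_unzip:
  assumes "prob_space A" "prob_space B" "finite I"
  shows "distr (PiM I (\<lambda>_. A \<Otimes>\<^sub>M B)) (PiM I (\<lambda>_. A) \<Otimes>\<^sub>M PiM I (\<lambda>_. B))
           (\<lambda>d. (\<lambda>i\<in>I. fst (d i), \<lambda>i\<in>I. snd (d i))) = PiM I (\<lambda>_. A) \<Otimes>\<^sub>M PiM I (\<lambda>_. B)"
proof -
  let ?Q = "PiM I (\<lambda>_. A) \<Otimes>\<^sub>M PiM I (\<lambda>_. B)"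
  have "distr (PiM I (\<lambda>_. A \<Otimes>\<^sub>M B)) ?Q (\<lambda>d. (\<lambda>i\<in>I. fst (d i), \<lambda>i\<in>I. snd (d i))) =
    distr ?Q ?Q ((\<lambda>d. (\<lambda>i\<in>I. fst (d i), \<lambda>i\<in>I. snd (d i))) \<circ> (\<lambda>(x, y). \<lambda>i\<in>I. (x i, y i)))"
    by (subst distr_PiM_zip[OF assms, symmetric], subst distr_distr) measurable
  also have "\<dots> = distr ?Q ?Q (\<lambda>z. z)"
    by (intro distr_cong)
       (auto simp: space_pair_measure space_PiM PiE_iff extensional_def restrict_def fun_eq_iff)
  finally show ?thesis by (simp add: distr_id)
qed

lemma distr_PiM_permute:
  assumes "prob_space A" "\<pi> permutes I"
  shows "distr (PiM I (\<lambda>_. A)) (PiM I (\<lambda>_. A)) (\<lambda>x. \<lambda>i\<in>I. x (\<pi> i)) = PiM I (\<lambda>_. A)"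
  using assms distr_PiM_reindex[of I "\<lambda>_. A" \<pi> I]
  by (auto simp: permutes_in_image permutes_inj_on)

text \<open>Equal point masses on a finite set of total mass 1 must each be
  \<open>1 / card A\<close>. This turns a symmetry argument into an explicit law.\<close>

lemma distr_eq_pmf_of_set:
  assumes "prob_space W" and Z[measurable]: "Z \<in> measurable W (count_space UNIV)"
    and "finite A" and A: "AE \<omega> in W. Z \<omega> \<in> A"
    and eq: "\<And>a b. a \<in> A \<Longrightarrow> b \<in> A \<Longrightarrow>
      emeasure W {\<omega> \<in> space W. Z \<omega> = a} = emeasure W {\<omega> \<in> space W. Z \<omega> = b}"
  shows "distr W (count_space UNIV) Z = measure_pmf (pmf_of_set A)"
proof -
  interpret W: prob_space W by fact
  define D where "D = distr W (count_space UNIV) Z"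
  interpret D: prob_space D unfolding D_def by (rule W.prob_space_distr) fact
  have sets_D[simp]: "sets D = UNIV" by (simp add: D_def)
  have AE_D: "AE z in D. z \<in> A"
    unfolding D_def using A by (subst AE_distr_iff) auto
  have "A \<noteq> {}" using A by auto
  have eq_D: "D.prob {a} = D.prob {b}" if "a \<in> A" "b \<in> A" for a b
    using eq[OF that] by (simp add: D_def measure_def emeasure_distr[OF Z] vimage_def Int_def conj_commute)
  have "D.prob A = 1"
    using AE_D D.prob_eq_1[of A] by simp
  moreover have "D.prob A = (\<Sum>a\<in>A. D.prob {a})"
    using \<open>finite A\<close> by (intro D.finite_measure_eq_sum_singleton) auto
  moreover have "(\<Sum>b\<in>A. D.prob {b}) = card A * D.prob {a}" if "a \<in> A" for a
    using sum.cong[OF refl eq_D[OF _ that]] by simp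
  ultimately have "D.prob {a} = 1 / card A" if "a \<in> A" for a
    using that \<open>finite A\<close> \<open>A \<noteq> {}\<close> by (simp add: field_simps)
  \<comment> \<open>Both measures are concentrated on the finite set \<open>A\<close>, so agreement
    on its points is enough even if the type is uncountable.\<close>
  then have "D = measure_pmf (pmf_of_set A)"
    using \<open>finite A\<close> \<open>A \<noteq> {}\<close> AE_D
    by (intro measure_eqI_countable_AE[where \<Omega> = A])
       (auto simp: AE_measure_pmf_iff countable_finite D.emeasure_eq_measure emeasure_pmf_single)
  then show ?thesis by (simp add: D_def)
qed

section \<open>Ranks for fixed jitters\<close>

lemma jitter_rank_cong:
  assumes "\<And>j. j \<in> {1..n} \<Longrightarrow> u j = u' j" "\<And>j. j \<in> {1..n} \<Longrightarrow> x j = x' j" "i \<in> {1..n}"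
  shows "jitter_rank \<xi> n u x i = jitter_rank \<xi> n u' x' i"
  unfolding jitter_rank_def using assms by (intro arg_cong[where f = card]) auto

text \<open>Relabelling data and jitters together preserves every comparison, so
  \<open>\<pi>\<close> is a bijection between the two sets being counted.\<close>

lemma jitter_rank_permute:
  assumes "\<pi> permutes {1..n}"
  shows "jitter_rank \<xi> n (\<lambda>j. u (\<pi> j)) (\<lambda>j. x (\<pi> j)) i = jitter_rank \<xi> n u x (\<pi> i)"
  unfolding jitter_rank_def
proof (rule bij_betw_same_card)
  show "bij_betw \<pi> {j \<in> {1..n}. x (\<pi> j) + \<xi> * u (\<pi> j) \<le> x (\<pi> i) + \<xi> * u (\<pi> i)}
          {j \<in> {1..n}. x j + \<xi> * u j \<le> x (\<pi> i) + \<xi> * u (\<pi> i)}"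
    using permutes_image[OF assms] permutes_inj_on[OF assms] permutes_in_image[OF assms]
    by (auto simp: bij_betw_def image_iff) (metis assms permutes_surj surjD)
qed

text \<open>The rank is strictly monotone in the jittered value, so without ties it is injective.
  Each index counts itself, so ranks lie in \<open>{1..n}\<close>, and an injective self-map of a
  finite set is onto.\<close>

lemma bij_betw_jitter_rank:
  assumes inj: "inj_on (\<lambda>j. x j + \<xi> * u j) {1..n}"
  shows "bij_betw (jitter_rank \<xi> n u x) {1..n} {1..n}"
proof -
  define z where "z j = x j + \<xi> * u j" for j
  have rank: "jitter_rank \<xi> n u x i = card {j \<in> {1..n}. z j \<le> z i}" for i
    by (simp add: jitter_rank_def z_def)
  have less: "jitter_rank \<xi> n u x i < jitter_rank \<xi> n u x k" if "z i < z k" "k \<in> {1..n}" for i k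
  proof -
    have "{j \<in> {1..n}. z j \<le> z i} \<subset> {j \<in> {1..n}. z j \<le> z k}"
    proof (rule psubsetI)
      \<comment> \<open>The index \<open>k\<close> belongs to the right-hand set only.\<close>
      show "{j \<in> {1..n}. z j \<le> z i} \<noteq> {j \<in> {1..n}. z j \<le> z k}"
        using that by (metis (mono_tags, lifting) mem_Collect_eq order_refl not_le)
    qed (use that in auto)
    then show ?thesis
      unfolding rank by (intro psubset_card_mono) auto
  qed
  have "inj_on (jitter_rank \<xi> n u x) {1..n}"
  proof (rule inj_onI)
    fix i k assume ik: "i \<in> {1..n}" "k \<in> {1..n}"
      "jitter_rank \<xi> n u x i = jitter_rank \<xi> n u x k"
    then have "z i = z k"
      using less[of i k] less[of k i] by fastforce
    with ik inj show "i = k" by (auto simp: z_def dest: inj_onD)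
  qed
  moreover have "jitter_rank \<xi> n u x ` {1..n} \<subseteq> {1..n}"
  proof safe
    fix i assume i: "i \<in> {1..n}"
    have "{j \<in> {1..n}. z j \<le> z i} \<noteq> {}" using i by auto
    then have "0 < card {j \<in> {1..n}. z j \<le> z i}" by (simp add: card_gt_0_iff)
    moreover have "card {j \<in> {1..n}. z j \<le> z i} \<le> card {1..n}" by (intro card_mono) auto
    ultimately show "jitter_rank \<xi> n u x i \<in> {1..n}" by (simp add: rank)
  qed
  ultimately show ?thesis
    by (simp add: bij_betw_def endo_inj_surj)
qed

section \<open>Rank vectors and the action of permutations on them\<close>

text \<open>Restriction makes the vector extensional, so that equality of functions means equality
  of the \<open>n\<close> ranks and the possible values form a finite set.\<close>

definition rank_vector :: "real \<Rightarrow> nat \<Rightarrow> (nat \<Rightarrow> real) \<Rightarrow> (nat \<Rightarrow> real) \<Rightarrow> nat \<Rightarrow> nat" where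
  "rank_vector \<xi> n u x = restrict (jitter_rank \<xi> n u x) {1..n}"

text \<open>The permutations of \<open>{1..n}\<close>, represented extensionally to match rank
  vectors; \<open>permutes\<close> would instead fix the points outside.\<close>

definition rank_orders :: "nat \<Rightarrow> (nat \<Rightarrow> nat) set" where
  "rank_orders n = {r \<in> extensional {1..n}. bij_betw r {1..n} {1..n}}"

lemma finite_rank_orders: "finite (rank_orders n)"
  by (rule finite_subset[of _ "{1..n} \<rightarrow>\<^sub>E {1..n}"])
     (auto simp: rank_orders_def PiE_def dest: bij_betwE simp del: atLeastAtMost_iff
       intro!: finite_PiE[unfolded PiE_def])

text \<open>The permutation is the inverse of \<open>r\<close> after \<open>s\<close>. Transitivity
  of this action is what will make all rank orders equally likely.\<close>

lemma rank_orders_transitive: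
  assumes "r \<in> rank_orders n" "s \<in> rank_orders n"
  obtains \<pi> where "\<pi> permutes {1..n}" "s = (\<lambda>i\<in>{1..n}. r (\<pi> i))"
proof
  let ?I = "{1..n}"
  \<comment> \<open>Outside \<open>?I\<close> the map must be the identity, as
    \<open>permutes\<close> demands.\<close>
  define \<pi> where "\<pi> i = (if i \<in> ?I then inv_into ?I r (s i) else i)" for i
  have r: "bij_betw r ?I ?I" and s: "bij_betw s ?I ?I" "s \<in> extensional ?I"
    using assms by (auto simp: rank_orders_def)
  have "bij_betw (inv_into ?I r \<circ> s) ?I ?I"
    using bij_betw_inv_into[OF r] s by (auto intro: bij_betw_trans)
  then have "bij_betw \<pi> ?I ?I"
    by (rule bij_betw_cong[THEN iffD1, rotated]) (simp add: \<pi>_def)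
  then show "\<pi> permutes ?I"
    by (rule bij_imp_permutes) (auto simp: \<pi>_def)
  show "s = (\<lambda>i\<in>?I. r (\<pi> i))"
  proof (rule extensionalityI[OF s(2) restrict_extensional])
    fix i assume i: "i \<in> ?I"
    then have "s i \<in> ?I" using s(1) by (rule bij_betw_apply[rotated])
    with i show "s i = (\<lambda>i\<in>?I. r (\<pi> i)) i"
      using bij_betw_inv_into_right[OF r] by (simp add: \<pi>_def)
  qed
qed

text \<open>Evaluation at \<open>inv \<pi> i\<close> undoes the permutation, and extensionality
  settles the remaining arguments. This recovers the original rank vector from the permuted
  one.\<close>

lemma inj_on_restrict_permute:
  assumes "\<pi> permutes I"
  shows "inj_on (\<lambda>r. \<lambda>i\<in>I. r (\<pi> i)) (extensional I)"
proof (rule inj_onI)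
  fix r s assume rs: "r \<in> extensional I" "s \<in> extensional I"
    and eq: "(\<lambda>i\<in>I. r (\<pi> i)) = (\<lambda>i\<in>I. s (\<pi> i))"
  show "r = s"
  proof (rule extensionalityI[OF rs])
    fix i assume "i \<in> I"
    then have "inv \<pi> i \<in> I" using assms by (metis permutes_inv permutes_in_image)
    with fun_cong[OF eq, of "inv \<pi> i"] show "r i = s i"
      using assms by (simp add: permutes_inverses)
  qed
qed

section \<open>Measurability of rank vectors\<close>

text \<open>The values lie in a finite set, so only preimages of points have to be checked. Starting
  the range at 0 makes its justification a plain cardinality bound.\<close>

lemma measurable_rank_vector:
  assumes u: "\<And>j. j \<in> {1..n} \<Longrightarrow> (\<lambda>\<omega>. u \<omega> j) \<in> borel_measurable M"
    and x: "\<And>j. j \<in> {1..n} \<Longrightarrow> (\<lambda>\<omega>. x \<omega> j) \<in> borel_measurable M"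
  shows "(\<lambda>\<omega>. rank_vector \<xi> n (u \<omega>) (x \<omega>)) \<in> measurable M (count_space ({1..n} \<rightarrow>\<^sub>E {0..n}))"
proof -
  have rank[measurable]: "(\<lambda>\<omega>. jitter_rank \<xi> n (u \<omega>) (x \<omega>) i) \<in> measurable M (count_space UNIV)"
    if "i \<in> {1..n}" for i
    unfolding jitter_rank_def
  proof (rule measurable_card)
    fix j
    \<comment> \<open>Measurability of the cardinality is reduced to the events that
      \<open>j\<close> is counted; for \<open>j\<close> outside \<open>{1..n}\<close> the event is
      empty.\<close>
    have "{\<omega> \<in> space M. j \<in> {j \<in> {1..n}. x \<omega> j + \<xi> * u \<omega> j \<le> x \<omega> i + \<xi> * u \<omega> i}} =
      (if j \<in> {1..n} then {\<omega> \<in> space M. x \<omega> j + \<xi> * u \<omega> j \<le> x \<omega> i + \<xi> * u \<omega> i} else {})"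
      by auto
    also have "\<dots> \<in> sets M"
      using that u x by (auto intro!: borel_measurable_le)
    finally show "{\<omega> \<in> space M. j \<in> {j \<in> {1..n}. x \<omega> j + \<xi> * u \<omega> j \<le> x \<omega> i + \<xi> * u \<omega> i}} \<in> sets M" .
  qed
  have le: "jitter_rank \<xi> n (u \<omega>) (x \<omega>) i \<le> n" for \<omega> i
    unfolding jitter_rank_def by (rule order_trans[OF card_mono[of "{1..n}"]]) auto
  have "(\<lambda>\<omega>. rank_vector \<xi> n (u \<omega>) (x \<omega>)) -` {r} \<inter> space M =
      {\<omega> \<in> space M. \<forall>i\<in>{1..n}. jitter_rank \<xi> n (u \<omega>) (x \<omega>) i = r i}"
    if "r \<in> {1..n} \<rightarrow>\<^sub>E {0..n}" for r
    using that by (auto simp: rank_vector_def fun_eq_iff PiE_iff extensional_def restrict_def)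
  moreover have "{\<omega> \<in> space M. \<forall>i\<in>{1..n}. jitter_rank \<xi> n (u \<omega>) (x \<omega>) i = r i} \<in> sets M" for r
    by measurable
  ultimately show ?thesis
    using le by (subst measurable_count_space_eq2)
      (auto simp: finite_PiE rank_vector_def)
qed

text \<open>Finiteness of \<open>?R\<close> makes the product of the two discrete spaces discrete,
  which gives measurability of the pair with respect to all sets of pairs of functions.\<close>

lemma measurable_rank_vector_pair:
  assumes "\<And>j. j \<in> {1..n} \<Longrightarrow> (\<lambda>\<omega>. u \<omega> j) \<in> borel_measurable M"
    and "\<And>j. j \<in> {1..n} \<Longrightarrow> (\<lambda>\<omega>. x \<omega> j) \<in> borel_measurable M"
    and "\<And>j. j \<in> {1..n} \<Longrightarrow> (\<lambda>\<omega>. v \<omega> j) \<in> borel_measurable M"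
    and "\<And>j. j \<in> {1..n} \<Longrightarrow> (\<lambda>\<omega>. y \<omega> j) \<in> borel_measurable M"
  shows "(\<lambda>\<omega>. (rank_vector \<xi> n (u \<omega>) (x \<omega>), rank_vector \<xi> n (v \<omega>) (y \<omega>)))
    \<in> measurable M (count_space UNIV)"
proof -
  let ?R = "{1..n} \<rightarrow>\<^sub>E {0..n}"
  have "(\<lambda>\<omega>. (rank_vector \<xi> n (u \<omega>) (x \<omega>), rank_vector \<xi> n (v \<omega>) (y \<omega>)))
    \<in> measurable M (count_space ?R \<Otimes>\<^sub>M count_space ?R)"
    by (intro measurable_Pair measurable_rank_vector assms)
  also have "count_space ?R \<Otimes>\<^sub>M count_space ?R = count_space (?R \<times> ?R)"
    by (simp add: pair_measure_count_space finite_PiE)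
  finally show ?thesis
    by (rule measurable_compose) simp
qed

section \<open>Permutation-invariant transformations\<close>

text \<open>Allows \<open>S\<close> to be replaced by a marginal law on \<open>S\<close>, which has
  the same measurable sets.\<close>

lemma perm_invariant_transform_cong_sets:
  assumes "sets S = sets S'"
  shows "perm_invariant_transform n S f \<longleftrightarrow> perm_invariant_transform n S' f"
proof -
  have P: "sets (PiM {1..n} (\<lambda>_. S)) = sets (PiM {1..n} (\<lambda>_. S'))"
    using assms by (intro sets_PiM_cong) auto
  show ?thesis
    unfolding perm_invariant_transform_def
      measurable_cong_sets[OF sets_pair_measure_cong[OF assms P] refl]
      sets_eq_imp_space_eq[OF assms] sets_eq_imp_space_eq[OF P] ..
qed

lemma perm_invariant_transform_eval: "perm_invariant_transform n borel (\<lambda>x d. x)"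
  by (simp add: perm_invariant_transform_def)

text \<open>A function on the canonical space of two samples and one jitter family, so that its law
  can be found under a product measure first and transferred to \<open>M\<close> afterwards.\<close>

definition rank_pair ::
  "real \<Rightarrow> nat \<Rightarrow> ('a \<Rightarrow> (nat \<Rightarrow> 'a) \<Rightarrow> real) \<Rightarrow> ('b \<Rightarrow> (nat \<Rightarrow> 'b) \<Rightarrow> real) \<Rightarrow>
    ((nat \<Rightarrow> 'a) \<times> (nat \<Rightarrow> 'b)) \<times> (nat + nat \<Rightarrow> real) \<Rightarrow> (nat \<Rightarrow> nat) \<times> (nat \<Rightarrow> nat)" where
  "rank_pair \<xi> n f g = (\<lambda>((x, y), w).
     (rank_vector \<xi> n (\<lambda>j. w (Inl j)) (\<lambda>j. f (x j) x),
      rank_vector \<xi> n (\<lambda>j. w (Inr j)) (\<lambda>j. g (y j) y)))"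

text \<open>Permutation invariance removes \<open>\<pi>\<close> from the data argument, so only the
  evaluation points move and the transformed values are themselves permuted by \<open>\<pi>\<close>.
  With the jitters permuted alike, the ranks follow.\<close>

lemma rank_vector_transform_permute:
  assumes f: "perm_invariant_transform n S f" and x: "x \<in> space (PiM {1..n} (\<lambda>_. S))"
    and \<pi>: "\<pi> permutes {1..n}"
    and u': "\<And>i. i \<in> {1..n} \<Longrightarrow> u' i = u (\<pi> i)"
    and x': "x' = (\<lambda>i\<in>{1..n}. x (\<pi> i))"
  shows "rank_vector \<xi> n u' (\<lambda>j. f (x' j) x') =
    (\<lambda>i\<in>{1..n}. rank_vector \<xi> n u (\<lambda>j. f (x j) x) (\<pi> i))"
proof
  fix i
  have mem: "\<pi> j \<in> {1..n}" if "j \<in> {1..n}" for j using \<pi> that by (simp only: permutes_in_image)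
  show "rank_vector \<xi> n u' (\<lambda>j. f (x' j) x') i =
    (\<lambda>i\<in>{1..n}. rank_vector \<xi> n u (\<lambda>j. f (x j) x) (\<pi> i)) i"
  proof (cases "i \<in> {1..n}")
    case True
    have "f (x' j) x' = f (x (\<pi> j)) x" if "j \<in> {1..n}" for j
    proof -
      have "x (\<pi> j) \<in> space S" using x mem[OF that] by (auto simp: space_PiM)
      then show ?thesis using f x \<pi> that by (simp add: perm_invariant_transform_def x')
    qed
    then have "jitter_rank \<xi> n u' (\<lambda>j. f (x' j) x') i =
      jitter_rank \<xi> n (\<lambda>j. u (\<pi> j)) (\<lambda>j. f (x (\<pi> j)) x) i"
      using True u' by (intro jitter_rank_cong) auto
    also have "\<dots> = jitter_rank \<xi> n u (\<lambda>j. f (x j) x) (\<pi> i)"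
      using jitter_rank_permute[OF \<pi>, of \<xi> u "\<lambda>j. f (x j) x" i] .
    finally show ?thesis using True mem[OF True] by (simp add: rank_vector_def)
  qed (auto simp: rank_vector_def)
qed

section \<open>Uniformity of the pair of rank vectors under a product measure\<close>

text \<open>For fixed data \<open>d\<close>, a tie fixes the difference of two jitters, which has
  probability zero; Fubini and finitely many pairs of indices do the rest. The map
  \<open>\<iota>\<close> stands for \<open>Inl\<close> or \<open>Inr\<close>, locating the jitters
  inside the joint family.\<close>

lemma AE_inj_on_jittered:
  fixes K :: "real measure" and h :: "'d \<Rightarrow> 'i \<Rightarrow> real"
  assumes D: "prob_space D" and K: "prob_space K" "sets K = sets borel" "\<And>c. emeasure K {c} = 0"
    and fin: "finite I" "finite L" and \<iota>: "inj_on \<iota> I" "\<iota> ` I \<subseteq> L" and "\<xi> \<noteq> 0"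
    and h[measurable]: "\<And>j. j \<in> I \<Longrightarrow> (\<lambda>d. h d j) \<in> borel_measurable D"
  shows "AE (d, w) in D \<Otimes>\<^sub>M PiM L (\<lambda>_. K). inj_on (\<lambda>j. h d j + \<xi> * w (\<iota> j)) I"
proof -
  interpret D: prob_space D by fact
  interpret K: prob_space K by fact
  interpret KL: product_prob_space "\<lambda>_. K" L ..
  interpret pair_prob_space D "PiM L (\<lambda>_. K)" ..
  note [measurable_cong] = K(2)
  have \<iota>_L[measurable]: "\<iota> j \<in> L" if "j \<in> I" for j using \<iota>(2) that by auto
  have "AE \<omega> in D \<Otimes>\<^sub>M PiM L (\<lambda>_. K).
      h (fst \<omega>) i + \<xi> * snd \<omega> (\<iota> i) \<noteq> h (fst \<omega>) k + \<xi> * snd \<omega> (\<iota> k)"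
    if ik: "i \<in> I" "k \<in> I" "i \<noteq> k" for i k
  proof (rule AE_pair_measure)
    note [measurable] = h[OF ik(1)] h[OF ik(2)] \<iota>_L[OF ik(1)] \<iota>_L[OF ik(2)]
    show "{\<omega> \<in> space (D \<Otimes>\<^sub>M PiM L (\<lambda>_. K)).
        h (fst \<omega>) i + \<xi> * snd \<omega> (\<iota> i) \<noteq> h (fst \<omega>) k + \<xi> * snd \<omega> (\<iota> k)}
      \<in> sets (D \<Otimes>\<^sub>M PiM L (\<lambda>_. K))"
      by measurable
    have "\<iota> i \<noteq> \<iota> k" using \<iota>(1) ik by (auto dest: inj_onD)
    \<comment> \<open>Solving the tie equation for \<open>w (\<iota> i) - w (\<iota> k)\<close>
      gives the quotient used as the shift.\<close>
    have "AE w in PiM L (\<lambda>_. K). h d i + \<xi> * w (\<iota> i) \<noteq> h d k + \<xi> * w (\<iota> k)" for d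
      using AE_PiM_component_neq[OF K fin(2) \<iota>_L[OF ik(1)] \<iota>_L[OF ik(2)] \<open>\<iota> i \<noteq> \<iota> k\<close>,
          of "(h d k - h d i) / \<xi>"]
      by eventually_elim (use \<open>\<xi> \<noteq> 0\<close> in \<open>auto simp: field_simps\<close>)
    then show "AE d in D. AE w in PiM L (\<lambda>_. K).
        h (fst (d, w)) i + \<xi> * snd (d, w) (\<iota> i) \<noteq> h (fst (d, w)) k + \<xi> * snd (d, w) (\<iota> k)"
      by simp
  qed
  then have "AE \<omega> in D \<Otimes>\<^sub>M PiM L (\<lambda>_. K). \<forall>i\<in>I. \<forall>k\<in>I. i \<noteq> k \<longrightarrow>
      h (fst \<omega>) i + \<xi> * snd \<omega> (\<iota> i) \<noteq> h (fst \<omega>) k + \<xi> * snd \<omega> (\<iota> k)"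
    using fin(1) by (intro AE_finite_allI) auto
  then show ?thesis
    unfolding inj_on_def split_beta by eventually_elim blast
qed

lemma measurable_perm_invariant_transform:
  assumes "perm_invariant_transform n S f" "j \<in> {1..n}"
  shows "(\<lambda>x. f (x j) x) \<in> borel_measurable (PiM {1..n} (\<lambda>_. S))"
proof -
  have "(\<lambda>(x, d). f x d) \<in> borel_measurable (S \<Otimes>\<^sub>M PiM {1..n} (\<lambda>_. S))"
    using assms by (simp add: perm_invariant_transform_def)
  moreover have "(\<lambda>x. (x j, x)) \<in> measurable (PiM {1..n} (\<lambda>_. S)) (S \<Otimes>\<^sub>M PiM {1..n} (\<lambda>_. S))"
    using assms(2) by measurable
  ultimately have "(\<lambda>x. case (x j, x) of (x, d) \<Rightarrow> f x d) \<in> borel_measurable (PiM {1..n} (\<lambda>_. S))"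
    by (rule measurable_compose[rotated])
  then show ?thesis by simp
qed

text \<open>Each of the three factors of \<open>W\<close> is invariant under reindexing. The product
  form of the first two, which is where the null hypothesis enters, permits \<open>\<pi>\<close> and
  \<open>\<rho>\<close> to be unrelated; the jitters follow through
  \<open>map_sum \<pi> \<rho>\<close>.\<close>

lemma distr_pair_permute:
  assumes A: "prob_space A" and B: "prob_space B" and K: "prob_space K"
    and \<pi>: "\<pi> permutes I" and \<rho>: "\<rho> permutes I"
  defines "W \<equiv> (PiM I (\<lambda>_. A) \<Otimes>\<^sub>M PiM I (\<lambda>_. B)) \<Otimes>\<^sub>M PiM (I <+> I) (\<lambda>_. K)"
  defines "T \<equiv> (\<lambda>((x, y), w). ((\<lambda>i\<in>I. x (\<pi> i), \<lambda>i\<in>I. y (\<rho> i)), \<lambda>k\<in>I <+> I. w (map_sum \<pi> \<rho> k)))"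
  shows "T \<in> measurable W W" and "distr W W T = W"
proof -
  have sum: "inj_on (map_sum \<pi> \<rho>) (I <+> I)" "map_sum \<pi> \<rho> \<in> I <+> I \<rightarrow> I <+> I"
    using \<pi> \<rho>
    by (auto simp: inj_on_def permutes_in_image inj_eq[OF permutes_inj[OF \<pi>]]
      inj_eq[OF permutes_inj[OF \<rho>]])
  have x: "(\<lambda>x. \<lambda>i\<in>I. x (\<pi> i)) \<in> measurable (PiM I (\<lambda>_. A)) (PiM I (\<lambda>_. A))"
    using \<pi> by (intro measurable_restrict measurable_component_singleton) (simp add: permutes_in_image)
  have y: "(\<lambda>x. \<lambda>i\<in>I. x (\<rho> i)) \<in> measurable (PiM I (\<lambda>_. B)) (PiM I (\<lambda>_. B))"
    using \<rho> by (intro measurable_restrict measurable_component_singleton) (simp add: permutes_in_image)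
  have w: "(\<lambda>w. \<lambda>k\<in>I <+> I. w (map_sum \<pi> \<rho> k))
      \<in> measurable (PiM (I <+> I) (\<lambda>_. K)) (PiM (I <+> I) (\<lambda>_. K))"
    using sum(2) by (intro measurable_restrict measurable_component_singleton) auto
  have xy: "(\<lambda>(x, y). (\<lambda>i\<in>I. x (\<pi> i), \<lambda>i\<in>I. y (\<rho> i)))
      \<in> measurable (PiM I (\<lambda>_. A) \<Otimes>\<^sub>M PiM I (\<lambda>_. B)) (PiM I (\<lambda>_. A) \<Otimes>\<^sub>M PiM I (\<lambda>_. B))"
    using x y by simp
  show "T \<in> measurable W W"
    using measurable_Pair[OF measurable_compose[OF measurable_fst xy] measurable_compose[OF measurable_snd w]]
    unfolding T_def W_def by (simp add: split_def)
  have sf_B: "sigma_finite_measure (PiM I (\<lambda>_. B))"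
    and sf_K: "sigma_finite_measure (PiM (I <+> I) (\<lambda>_. K))"
    using B K by (simp_all add: prob_space_PiM prob_space_imp_sigma_finite)
  have distr_xy: "distr (PiM I (\<lambda>_. A) \<Otimes>\<^sub>M PiM I (\<lambda>_. B)) (PiM I (\<lambda>_. A) \<Otimes>\<^sub>M PiM I (\<lambda>_. B))
      (\<lambda>(x, y). (\<lambda>i\<in>I. x (\<pi> i), \<lambda>i\<in>I. y (\<rho> i))) = PiM I (\<lambda>_. A) \<Otimes>\<^sub>M PiM I (\<lambda>_. B)"
    using pair_measure_distr[OF x y] sf_B
    by (simp add: distr_PiM_permute[OF A \<pi>] distr_PiM_permute[OF B \<rho>])
  have distr_w: "distr (PiM (I <+> I) (\<lambda>_. K)) (PiM (I <+> I) (\<lambda>_. K))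
      (\<lambda>w. \<lambda>k\<in>I <+> I. w (map_sum \<pi> \<rho> k)) = PiM (I <+> I) (\<lambda>_. K)"
    using distr_PiM_reindex[of "I <+> I" "\<lambda>_. K", OF K sum] by simp
  show "distr W W T = W"
    using pair_measure_distr[OF xy w] sf_K
    by (simp add: distr_xy[unfolded split_def] distr_w W_def T_def split_def)
qed

text \<open>Any pair of rank orders is carried to any other by a transformation preserving
  \<open>W\<close>, so all pairs have the same probability; absence of ties shows that no mass lies
  elsewhere.\<close>

lemma distr_rank_pair:
  fixes K :: "real measure"
  assumes A: "prob_space A" and B: "prob_space B"
    and K: "prob_space K" "sets K = sets borel" "\<And>c. emeasure K {c} = 0"
    and f: "perm_invariant_transform n A f" and g: "perm_invariant_transform n B g"
    and "\<xi> \<noteq> 0"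
  defines "W \<equiv> (PiM {1..n} (\<lambda>_. A) \<Otimes>\<^sub>M PiM {1..n} (\<lambda>_. B)) \<Otimes>\<^sub>M PiM ({1..n} <+> {1..n}) (\<lambda>_. K)"
  shows "rank_pair \<xi> n f g \<in> measurable W (count_space UNIV)"
    and "distr W (count_space UNIV) (rank_pair \<xi> n f g) =
      measure_pmf (pmf_of_set (rank_orders n \<times> rank_orders n))"
proof -
  let ?I = "{1..n}"
  let ?D = "PiM ?I (\<lambda>_. A) \<Otimes>\<^sub>M PiM ?I (\<lambda>_. B)"
  interpret A: prob_space A by fact
  interpret B: prob_space B by fact
  interpret K: prob_space K by fact
  interpret PA: product_prob_space "\<lambda>_. A" ?I ..
  interpret PB: product_prob_space "\<lambda>_. B" ?I ..
  interpret PK: product_prob_space "\<lambda>_. K" "?I <+> ?I" ..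
  interpret D: pair_prob_space "PiM ?I (\<lambda>_. A)" "PiM ?I (\<lambda>_. B)" ..
  interpret W: pair_prob_space ?D "PiM (?I <+> ?I) (\<lambda>_. K)" ..
  have f_D: "(\<lambda>d. f (fst d j) (fst d)) \<in> borel_measurable ?D"
    and g_D: "(\<lambda>d. g (snd d j) (snd d)) \<in> borel_measurable ?D" if "j \<in> ?I" for j
    using measurable_compose[OF measurable_fst measurable_perm_invariant_transform[OF f that]]
      measurable_compose[OF measurable_snd measurable_perm_invariant_transform[OF g that]]
    by auto
  have w_W: "(\<lambda>\<omega>. snd \<omega> k) \<in> borel_measurable W" if "k \<in> ?I <+> ?I" for k
    unfolding W_def measurable_cong_sets[OF refl K(2), symmetric]
    by (rule measurable_compose[OF measurable_snd measurable_component_singleton[OF that]])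
  show Z: "rank_pair \<xi> n f g \<in> measurable W (count_space UNIV)"
    unfolding rank_pair_def split_def
  proof (rule measurable_rank_vector_pair)
    fix j assume j: "j \<in> ?I"
    show "(\<lambda>\<omega>. f (fst (fst \<omega>) j) (fst (fst \<omega>))) \<in> borel_measurable W"
      "(\<lambda>\<omega>. g (snd (fst \<omega>) j) (snd (fst \<omega>))) \<in> borel_measurable W"
      using measurable_compose[OF measurable_fst f_D[OF j]]
        measurable_compose[OF measurable_fst g_D[OF j]] by (simp_all add: W_def)
    show "(\<lambda>\<omega>. snd \<omega> (Inl j)) \<in> borel_measurable W" "(\<lambda>\<omega>. snd \<omega> (Inr j)) \<in> borel_measurable W"
      using j by (auto intro!: w_W)
  qed
  show "distr W (count_space UNIV) (rank_pair \<xi> n f g) =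
      measure_pmf (pmf_of_set (rank_orders n \<times> rank_orders n))"
  proof (rule distr_eq_pmf_of_set[OF _ Z])
    show "prob_space W" unfolding W_def by (rule W.prob_space_axioms)
    show "finite (rank_orders n \<times> rank_orders n)" by (simp add: finite_rank_orders)
    have "AE (d, w) in W. inj_on (\<lambda>j. f (fst d j) (fst d) + \<xi> * w (Inl j)) ?I"
      unfolding W_def using f_D \<open>\<xi> \<noteq> 0\<close>
      by (intro AE_inj_on_jittered[OF D.prob_space_axioms K]) auto
    moreover have "AE (d, w) in W. inj_on (\<lambda>j. g (snd d j) (snd d) + \<xi> * w (Inr j)) ?I"
      unfolding W_def using g_D \<open>\<xi> \<noteq> 0\<close>
      by (intro AE_inj_on_jittered[OF D.prob_space_axioms K]) auto
    ultimately show "AE \<omega> in W. rank_pair \<xi> n f g \<omega> \<in> rank_orders n \<times> rank_orders n"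
      by eventually_elim
        (auto simp: rank_pair_def rank_orders_def rank_vector_def split_def
          simp del: atLeastAtMost_iff One_nat_def intro!: bij_betw_jitter_rank)
    fix a b assume "a \<in> rank_orders n \<times> rank_orders n" "b \<in> rank_orders n \<times> rank_orders n"
    then obtain r s r' s' where ab: "a = (r, s)" "b = (r', s')"
      and mem: "r \<in> rank_orders n" "s \<in> rank_orders n" "r' \<in> rank_orders n" "s' \<in> rank_orders n"
      by auto
    \<comment> \<open>The two permutations are chosen separately, one for each coordinate of the
      pair.\<close>
    obtain \<pi> where \<pi>: "\<pi> permutes ?I" "r' = (\<lambda>i\<in>?I. r (\<pi> i))"
      using rank_orders_transitive[OF mem(1,3)] .
    obtain \<rho> where \<rho>: "\<rho> permutes ?I" "s' = (\<lambda>i\<in>?I. s (\<rho> i))"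
      using rank_orders_transitive[OF mem(2,4)] .
    let ?T = "\<lambda>((x, y), w). ((\<lambda>i\<in>?I. x (\<pi> i), \<lambda>i\<in>?I. y (\<rho> i)),
      \<lambda>k\<in>?I <+> ?I. w (map_sum \<pi> \<rho> k))"
    note T = distr_pair_permute[OF A B K(1) \<pi>(1) \<rho>(1), folded W_def]
    \<comment> \<open>Since precomposition with a permutation is injective on extensional vectors,
      reaching \<open>b\<close> after \<open>?T\<close> is the same event as having \<open>a\<close>
      before it.\<close>
    have ZT: "rank_pair \<xi> n f g (?T \<omega>) = b \<longleftrightarrow> rank_pair \<xi> n f g \<omega> = a" if \<omega>: "\<omega> \<in> space W" for \<omega>
    proof -
      obtain x y w where \<omega>_eq: "\<omega> = ((x, y), w)" by (metis surj_pair)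
      have x: "x \<in> space (PiM ?I (\<lambda>_. A))" and y: "y \<in> space (PiM ?I (\<lambda>_. B))"
        using \<omega> by (auto simp: \<omega>_eq W_def space_pair_measure)
      let ?r = "rank_vector \<xi> n (\<lambda>j. w (Inl j)) (\<lambda>j. f (x j) x)"
      let ?s = "rank_vector \<xi> n (\<lambda>j. w (Inr j)) (\<lambda>j. g (y j) y)"
      have "rank_pair \<xi> n f g (?T \<omega>) = (\<lambda>i\<in>?I. ?r (\<pi> i), \<lambda>i\<in>?I. ?s (\<rho> i))"
        unfolding rank_pair_def \<omega>_eq prod.case
        by (intro arg_cong2[where f = Pair] rank_vector_transform_permute[OF f x \<pi>(1)]
          rank_vector_transform_permute[OF g y \<rho>(1)]) auto
      moreover have "?r \<in> extensional ?I" "?s \<in> extensional ?I"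
        by (simp_all add: rank_vector_def)
      moreover have "r \<in> extensional ?I" "s \<in> extensional ?I"
        using mem by (simp_all add: rank_orders_def)
      ultimately show ?thesis
        using inj_on_eq_iff[OF inj_on_restrict_permute[OF \<pi>(1)], of ?r r]
          inj_on_eq_iff[OF inj_on_restrict_permute[OF \<rho>(1)], of ?s s]
        by (simp add: ab \<pi>(2) \<rho>(2) \<omega>_eq rank_pair_def)
    qed
    \<comment> \<open>Invariance of \<open>W\<close> under \<open>?T\<close> lets the event be
      pulled back along \<open>?T\<close>.\<close>
    have "emeasure W {\<omega> \<in> space W. rank_pair \<xi> n f g \<omega> = b} =
        emeasure (distr W W ?T) {\<omega> \<in> space W. rank_pair \<xi> n f g \<omega> = b}"
      by (simp only: T(2))
    also have "\<dots> = emeasure W {\<omega> \<in> space W. rank_pair \<xi> n f g (?T \<omega>) = b}"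
      by (rule emeasure_Collect_distr[OF T(1)]) (use Z in measurable)
    also have "{\<omega> \<in> space W. rank_pair \<xi> n f g (?T \<omega>) = b} =
        {\<omega> \<in> space W. rank_pair \<xi> n f g \<omega> = a}"
      using ZT by auto
    finally show "emeasure W {\<omega> \<in> space W. rank_pair \<xi> n f g \<omega> = a} =
        emeasure W {\<omega> \<in> space W. rank_pair \<xi> n f g \<omega> = b}" ..
  qed
qed

section \<open>The joint law of the sample and its jitters\<close>

text \<open>Independence is exactly agreement with the product measure on rectangles, and these
  determine it. The hypothesis has the form in which the independence of data and jitters is
  assumed.\<close>

lemma (in prob_space) distr_pair_indep_set:
  assumes X[measurable]: "X \<in> measurable M S" and Y[measurable]: "Y \<in> measurable M T"
    and indep: "indep_set {X -` A \<inter> space M | A. A \<in> sets S} {Y -` B \<inter> space M | B. B \<in> sets T}"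
  shows "distr M (S \<Otimes>\<^sub>M T) (\<lambda>\<omega>. (X \<omega>, Y \<omega>)) = distr M S X \<Otimes>\<^sub>M distr M T Y"
proof (rule pair_measure_eqI[symmetric])
  fix A B assume "A \<in> sets (distr M S X)" "B \<in> sets (distr M T Y)"
  then have A[measurable]: "A \<in> sets S" and B[measurable]: "B \<in> sets T" by auto
  have "emeasure M ((X -` A \<inter> space M) \<inter> (Y -` B \<inter> space M)) =
      emeasure M (X -` A \<inter> space M) * emeasure M (Y -` B \<inter> space M)"
  proof -
    have "prob ((X -` A \<inter> space M) \<inter> (Y -` B \<inter> space M)) =
        prob (X -` A \<inter> space M) * prob (Y -` B \<inter> space M)"
      using A B by (intro indep_setD[OF indep]) blast+
    then show ?thesis by (simp add: emeasure_eq_measure ennreal_mult)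
  qed
  also have "(X -` A \<inter> space M) \<inter> (Y -` B \<inter> space M) =
      (\<lambda>\<omega>. (X \<omega>, Y \<omega>)) -` (A \<times> B) \<inter> space M"
    by auto
  finally show "emeasure (distr M S X) A * emeasure (distr M T Y) B =
      emeasure (distr M (S \<Otimes>\<^sub>M T) (\<lambda>\<omega>. (X \<omega>, Y \<omega>))) (A \<times> B)"
    by (simp add: emeasure_distr)
qed (auto intro!: prob_space_imp_sigma_finite prob_space_distr X Y)

definition jitter_law :: "real measure" where
  "jitter_law = uniform_measure lborel {-1..1}"

lemma prob_space_jitter_law: "prob_space jitter_law"
  unfolding jitter_law_def by (rule prob_space_uniform_measure) auto

lemma sets_jitter_law: "sets jitter_law = sets borel"
  by (simp add: jitter_law_def)

lemma emeasure_jitter_law_singleton: "emeasure jitter_law {c} = 0"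
proof -
  have "emeasure lborel ({-1..1} \<inter> {c}) \<le> emeasure lborel {c}"
    by (intro emeasure_mono) auto
  then show ?thesis by (simp add: jitter_law_def)
qed

text \<open>The vector of pairs and the jitter vector have product laws and are independent, so
  their joint law is a product. When \<open>P\<close> is a product, unzipping the pairs separates
  the two samples as well.\<close>

lemma (in jittered_iid_sample) distr_sample_jitter:
  assumes "n \<noteq> 0" and A: "prob_space A" and B: "prob_space B" and P: "P = A \<Otimes>\<^sub>M B"
  defines "W \<equiv> (PiM {1..n} (\<lambda>_. A) \<Otimes>\<^sub>M PiM {1..n} (\<lambda>_. B)) \<Otimes>\<^sub>M
    PiM ({1..n} <+> {1..n}) (\<lambda>_. jitter_law)"
  defines "H \<equiv> (\<lambda>\<omega>. ((\<lambda>i\<in>{1..n}. X i \<omega>, \<lambda>i\<in>{1..n}. Y i \<omega>),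
    \<lambda>k\<in>{1..n} <+> {1..n}. case_sum U V k \<omega>))"
  shows "H \<in> measurable M W" and "distr M W H = W"
proof -
  let ?I = "{1..n}"
  let ?D = "\<lambda>\<omega>. \<lambda>i\<in>?I. (X i \<omega>, Y i \<omega>)"
  let ?J = "\<lambda>\<omega>. \<lambda>k\<in>?I <+> ?I. case_sum U V k \<omega>"
  let ?unzip = "\<lambda>d. (\<lambda>i\<in>?I. fst (d i), \<lambda>i\<in>?I. snd (d i))"
  let ?Q = "PiM ?I (\<lambda>_. A) \<Otimes>\<^sub>M PiM ?I (\<lambda>_. B)"
  have rv_Z: "(\<lambda>\<omega>. (X i \<omega>, Y i \<omega>)) \<in> measurable M P" if "i \<in> ?I" for i
    using pairs_indep that by (auto simp: indep_vars_def)
  have rv_J: "case_sum U V k \<in> borel_measurable M" if "k \<in> ?I <+> ?I" for k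
    using jitter_indep that by (auto simp: indep_vars_def)
  have D: "?D \<in> measurable M (PiM ?I (\<lambda>_. P))"
    by (intro measurable_restrict rv_Z)
  have J: "?J \<in> measurable M (PiM (?I <+> ?I) (\<lambda>_. borel))"
    by (intro measurable_restrict rv_J)
  \<comment> \<open>Here \<open>n \<noteq> 0\<close> makes the index set nonempty, as the
    characterisation of independence by product laws requires.\<close>
  have "distr M (PiM ?I (\<lambda>_. P)) ?D = PiM ?I (\<lambda>i. distr M P (\<lambda>\<omega>. (X i \<omega>, Y i \<omega>)))"
    using pairs_indep rv_Z \<open>n \<noteq> 0\<close> by (subst (asm) indep_vars_iff_distr_eq_PiM') auto
  also have "\<dots> = PiM ?I (\<lambda>_. P)"
    using pairs_distr by (intro PiM_cong) auto
  finally have distr_D: "distr M (PiM ?I (\<lambda>_. P)) ?D = PiM ?I (\<lambda>_. P)" .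
  have "distr M (PiM (?I <+> ?I) (\<lambda>_. borel)) ?J = PiM (?I <+> ?I) (\<lambda>k. distr M borel (case_sum U V k))"
    using jitter_indep rv_J \<open>n \<noteq> 0\<close> by (subst (asm) indep_vars_iff_distr_eq_PiM') auto
  also have "\<dots> = PiM (?I <+> ?I) (\<lambda>_. jitter_law)"
    using U_distr V_distr by (intro PiM_cong) (auto simp: jitter_law_def)
  finally have distr_J: "distr M (PiM (?I <+> ?I) (\<lambda>_. borel)) ?J = PiM (?I <+> ?I) (\<lambda>_. jitter_law)" .
  have joint: "distr M (PiM ?I (\<lambda>_. P) \<Otimes>\<^sub>M PiM (?I <+> ?I) (\<lambda>_. borel)) (\<lambda>\<omega>. (?D \<omega>, ?J \<omega>)) =
      PiM ?I (\<lambda>_. P) \<Otimes>\<^sub>M PiM (?I <+> ?I) (\<lambda>_. jitter_law)"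
    using distr_pair_indep_set[OF D J data_jitter_indep] by (simp only: distr_D distr_J)
  have unzip: "?unzip \<in> measurable (PiM ?I (\<lambda>_. P)) ?Q"
    unfolding P by measurable
  \<comment> \<open>The measures \<open>borel\<close> and \<open>jitter_law\<close> have the same
    measurable sets, so the identity passes between their powers.\<close>
  have id: "(\<lambda>w. w) \<in> measurable (PiM (?I <+> ?I) (\<lambda>_. borel)) (PiM (?I <+> ?I) (\<lambda>_. jitter_law))"
    by (intro measurable_ident_sets sets_PiM_cong) (auto simp: sets_jitter_law)
  let ?h = "\<lambda>(d, w). (?unzip d, w)"
  have h: "?h \<in> measurable (PiM ?I (\<lambda>_. P) \<Otimes>\<^sub>M PiM (?I <+> ?I) (\<lambda>_. borel)) W"
    unfolding W_def using unzip id by measurable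
  have DJ: "(\<lambda>\<omega>. (?D \<omega>, ?J \<omega>)) \<in> measurable M (PiM ?I (\<lambda>_. P) \<Otimes>\<^sub>M PiM (?I <+> ?I) (\<lambda>_. borel))"
    using D J by (rule measurable_Pair)
  \<comment> \<open>The assumed independence concerns the vector of pairs, so the unzipping is
    applied after the joint law is known.\<close>
  have H: "H = ?h \<circ> (\<lambda>\<omega>. (?D \<omega>, ?J \<omega>))"
    by (auto simp: H_def fun_eq_iff)
  show "H \<in> measurable M W"
    unfolding H using DJ h by (rule measurable_comp)
  have sf: "sigma_finite_measure (PiM (?I <+> ?I) (\<lambda>_. jitter_law))"
    by (intro prob_space_imp_sigma_finite prob_space_PiM prob_space_jitter_law)
  have "distr M W H = distr (PiM ?I (\<lambda>_. P) \<Otimes>\<^sub>M PiM (?I <+> ?I) (\<lambda>_. jitter_law)) W ?h"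
    unfolding H distr_distr[OF h DJ, symmetric] joint ..
  also have "\<dots> = distr (PiM ?I (\<lambda>_. P)) ?Q ?unzip \<Otimes>\<^sub>M
      distr (PiM (?I <+> ?I) (\<lambda>_. jitter_law)) (PiM (?I <+> ?I) (\<lambda>_. jitter_law)) (\<lambda>w. w)"
    unfolding W_def using unzip sf by (intro pair_measure_distr[symmetric]) (auto simp: distr_id)
  also have "\<dots> = W"
    unfolding P W_def by (simp add: distr_PiM_unzip[OF A B] distr_id)
  finally show "distr M W H = W" .
qed

section \<open>The law of Spearman's correlation\<close>

text \<open>The statistic is a fixed function of the two rank vectors. The right-hand side involves
  \<open>n\<close> alone, so any two samples of this size can be compared through it.\<close>

lemma (in jittered_iid_sample) distr_spearman_rho:
  assumes "n \<noteq> 0" "\<xi> \<noteq> 0" and H0: "P = distr P S fst \<Otimes>\<^sub>M distr P T snd"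
    and f: "perm_invariant_transform n S f" and g: "perm_invariant_transform n T g"
  shows "distr M borel (\<lambda>\<omega>. spearman_rho \<xi> n (\<lambda>j. U j \<omega>) (\<lambda>j. V j \<omega>)
      (\<lambda>j. f (X j \<omega>) (\<lambda>k\<in>{1..n}. X k \<omega>)) (\<lambda>j. g (Y j \<omega>) (\<lambda>k\<in>{1..n}. Y k \<omega>))) =
    distr (measure_pmf (pmf_of_set (rank_orders n \<times> rank_orders n))) borel
      (\<lambda>(r, s). 1 - 6 / real n * (\<Sum>i=1..n. (real (r i) - real (s i))\<^sup>2 / ((real n)\<^sup>2 - 1)))"
    (is "distr M borel ?rho = distr ?R borel ?h")
proof -
  interpret P: prob_space P by (rule prob_P)
  let ?A = "distr P S fst" and ?B = "distr P T snd"
  have fst: "fst \<in> measurable P S" and snd: "snd \<in> measurable P T"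
    using sets_P by (simp_all cong: measurable_cong_sets)
  have A: "prob_space ?A" and B: "prob_space ?B"
    by (intro P.prob_space_distr fst snd)+
  let ?W = "(PiM {1..n} (\<lambda>_. ?A) \<Otimes>\<^sub>M PiM {1..n} (\<lambda>_. ?B)) \<Otimes>\<^sub>M
    PiM ({1..n} <+> {1..n}) (\<lambda>_. jitter_law)"
  let ?H = "\<lambda>\<omega>. ((\<lambda>i\<in>{1..n}. X i \<omega>, \<lambda>i\<in>{1..n}. Y i \<omega>),
    \<lambda>k\<in>{1..n} <+> {1..n}. case_sum U V k \<omega>)"
  note H = distr_sample_jitter[OF \<open>n \<noteq> 0\<close> A B H0]
  have fg: "perm_invariant_transform n ?A f" "perm_invariant_transform n ?B g"
    using f g by (simp_all cong: perm_invariant_transform_cong_sets)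
  note Z = distr_rank_pair[OF A B prob_space_jitter_law sets_jitter_law
      emeasure_jitter_law_singleton fg \<open>\<xi> \<noteq> 0\<close>]
  \<comment> \<open>Ranks only read indices in \<open>{1..n}\<close>, where the restricted vectors
    of the canonical space agree with the original variables.\<close>
  have "jitter_rank \<xi> n (\<lambda>j. (\<lambda>k\<in>{1..n} <+> {1..n}. case_sum U V k \<omega>) (Inl j))
      (\<lambda>j. f ((\<lambda>i\<in>{1..n}. X i \<omega>) j) (\<lambda>i\<in>{1..n}. X i \<omega>)) i =
    jitter_rank \<xi> n (\<lambda>j. U j \<omega>) (\<lambda>j. f (X j \<omega>) (\<lambda>k\<in>{1..n}. X k \<omega>)) i"
    "jitter_rank \<xi> n (\<lambda>j. (\<lambda>k\<in>{1..n} <+> {1..n}. case_sum U V k \<omega>) (Inr j))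
      (\<lambda>j. g ((\<lambda>i\<in>{1..n}. Y i \<omega>) j) (\<lambda>i\<in>{1..n}. Y i \<omega>)) i =
    jitter_rank \<xi> n (\<lambda>j. V j \<omega>) (\<lambda>j. g (Y j \<omega>) (\<lambda>k\<in>{1..n}. Y k \<omega>)) i"
    if "i \<in> {1..n}" for i \<omega>
    using that by (auto intro!: jitter_rank_cong)
  then have "?rho = ?h \<circ> (rank_pair \<xi> n f g \<circ> ?H)"
    by (auto simp: fun_eq_iff spearman_rho_def rank_pair_def rank_vector_def intro!: sum.cong)
  then have "distr M borel ?rho =
      distr (distr (distr M ?W ?H) (count_space UNIV) (rank_pair \<xi> n f g)) borel ?h"
    using H(1) Z(1) by (simp add: distr_distr measurable_comp)
  also have "\<dots> = distr ?R borel ?h"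
    unfolding H(2) Z(2) ..
  finally show ?thesis .
qed

theorem theorem6:
  fixes n :: nat and \<xi> \<xi>' :: real
    and M :: "'w measure" and S :: "'a measure" and T :: "'b measure"
    and P :: "('a \<times> 'b) measure"
    and X :: "nat \<Rightarrow> 'w \<Rightarrow> 'a" and Y :: "nat \<Rightarrow> 'w \<Rightarrow> 'b" and U V :: "nat \<Rightarrow> 'w \<Rightarrow> real"
    and fX :: "'a \<Rightarrow> (nat \<Rightarrow> 'a) \<Rightarrow> real" and fY :: "'b \<Rightarrow> (nat \<Rightarrow> 'b) \<Rightarrow> real"
    and M' :: "'v measure" and P' :: "(real \<times> real) measure"
    and X' Y' U' V' :: "nat \<Rightarrow> 'v \<Rightarrow> real"
  assumes "n \<ge> 2" and "\<xi> > 0" and "\<xi>' > 0"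
    and sample: "jittered_iid_sample M n S T P X Y U V"
    and H0: "P = distr P S fst \<Otimes>\<^sub>M distr P T snd"
    and fX: "perm_invariant_transform n S fX"
    and fY: "perm_invariant_transform n T fY"
    and real_sample: "jittered_iid_sample M' n borel borel P' X' Y' U' V'"
    and real_H0: "P' = distr P' borel fst \<Otimes>\<^sub>M distr P' borel snd"
  shows "distr M borel
           (\<lambda>\<omega>. spearman_rho \<xi> n (\<lambda>j. U j \<omega>) (\<lambda>j. V j \<omega>)
                  (\<lambda>j. fX (X j \<omega>) (\<lambda>k\<in>{1..n}. X k \<omega>))
                  (\<lambda>j. fY (Y j \<omega>) (\<lambda>k\<in>{1..n}. Y k \<omega>)))
       = distr M' borel
           (\<lambda>\<omega>. spearman_rho \<xi>' n (\<lambda>j. U' j \<omega>) (\<lambda>j. V' j \<omega>)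
                  (\<lambda>j. X' j \<omega>) (\<lambda>j. Y' j \<omega>))"
proof -
  have "n \<noteq> 0" "\<xi> \<noteq> 0" "\<xi>' \<noteq> 0" using assms by auto
  \<comment> \<open>Both sides equal the law that depends on \<open>n\<close> alone; the real sample
    uses the transformations returning their evaluation point.\<close>
  then show ?thesis
    using jittered_iid_sample.distr_spearman_rho[OF sample _ _ H0 fX fY]
      jittered_iid_sample.distr_spearman_rho[OF real_sample _ _ real_H0
        perm_invariant_transform_eval perm_invariant_transform_eval]
    by simp
qed

end
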